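(* Let $H$ be an infinite dimensional complex Hilbert space and denote by $B(H)$ the ring of all bounded linear operators on $H$. Then every operator $A\in B(H)$ can be decomposed as a sum of at most four nilpotent operators in $B(H)$ of nilpotency index at most $3$, and every $A\in B(H)$ can be decomposed as a sum of at most four automorphisms of order $3$.
   Context: An automorphism of order $3$ is an invertible operator $T\in B(H)$ that has order $3$ in the group of units of $B(H)$ (that is, $T^3=1_H$ and $T\neq 1_H$). *)

theory Defs
  imports "HOL-Analysis.Analysis"
begin

text \<open>
  The real scalar multiplication and the norm of \<^class>\<open>real_normed_vector\<close> are tied to the
  complex structure by \<open>scaleR_scaleC\<close> and \<open>norm_eq_sqrt_cinner\<close>, so \<^class>\<open>banach\<close> only
  adds completeness with respect to the norm of the inner product. The inner product is
  antilinear in the first and linear in the second argument.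
\<close>

class chilbert_space = banach +
  fixes scaleC :: "complex \<Rightarrow> 'a \<Rightarrow> 'a"  (infixr \<open>*\<^sub>C\<close> 75)
    and cinner :: "'a \<Rightarrow> 'a \<Rightarrow> complex"
  assumes scaleC_add_right: "c *\<^sub>C (x + y) = c *\<^sub>C x + c *\<^sub>C y"
    and scaleC_add_left: "(c + d) *\<^sub>C x = c *\<^sub>C x + d *\<^sub>C x"
    and scaleC_scaleC: "c *\<^sub>C (d *\<^sub>C x) = (c * d) *\<^sub>C x"
    and scaleC_one: "1 *\<^sub>C x = x"
    and scaleR_scaleC: "scaleR r x = complex_of_real r *\<^sub>C x"
    and cinner_commute: "cinner x y = cnj (cinner y x)"
    and cinner_add_right: "cinner x (y + z) = cinner x y + cinner x z"
    and cinner_scaleC_right: "cinner x (c *\<^sub>C y) = c * cinner x y"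
    and cinner_ge_zero: "Im (cinner x x) = 0 \<and> 0 \<le> Re (cinner x x)"
    and cinner_eq_zero_iff: "cinner x x = 0 \<longleftrightarrow> x = 0"
    and norm_eq_sqrt_cinner: "norm x = sqrt (Re (cinner x x))"

global_interpretation complex_vector: vector_space "scaleC :: complex \<Rightarrow> 'a \<Rightarrow> 'a::chilbert_space"
  defines cspan = complex_vector.span
  by unfold_locales (auto simp: scaleC_add_right scaleC_add_left scaleC_scaleC scaleC_one)

definition infinite_cdim :: "'a::chilbert_space itself \<Rightarrow> bool" where
  "infinite_cdim _ \<longleftrightarrow> \<not> (\<exists>B :: 'a set. finite B \<and> cspan B = UNIV)"

definition bounded_clinear :: "('a::chilbert_space \<Rightarrow> 'a) \<Rightarrow> bool" where
  "bounded_clinear f \<longleftrightarrow> bounded_linear f \<and> (\<forall>c x. f (c *\<^sub>C x) = c *\<^sub>C f x)"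

text \<open>The ring \<open>B(H)\<close>, with composition as multiplication. It is not made an instance of
  \<^class>\<open>ring_1\<close>, which would require \<open>0 \<noteq> 1\<close> and so exclude \<open>H = 0\<close>.\<close>

typedef (overloaded) 'a bop = "{f :: 'a::chilbert_space \<Rightarrow> 'a. bounded_clinear f}"
  morphisms bop_apply Bop
proof
  show "(\<lambda>x. x) \<in> {f :: 'a \<Rightarrow> 'a. bounded_clinear f}"
    by (simp add: bounded_clinear_def bounded_linear_ident)
qed

setup_lifting type_definition_bop

instantiation bop :: (chilbert_space) "{ring, monoid_mult}"
begin

lift_definition zero_bop :: "'a bop" is "\<lambda>x. 0"
  by (simp add: bounded_clinear_def complex_vector.scale_zero_right)

lift_definition one_bop :: "'a bop" is "\<lambda>x. x"
  by (simp add: bounded_clinear_def bounded_linear_ident)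

lift_definition plus_bop :: "'a bop \<Rightarrow> 'a bop \<Rightarrow> 'a bop" is "\<lambda>f g x. f x + g x"
  by (simp add: bounded_clinear_def bounded_linear_add scaleC_add_right)

lift_definition uminus_bop :: "'a bop \<Rightarrow> 'a bop" is "\<lambda>f x. - f x"
  by (simp add: bounded_clinear_def bounded_linear_minus complex_vector.scale_minus_right)

lift_definition minus_bop :: "'a bop \<Rightarrow> 'a bop \<Rightarrow> 'a bop" is "\<lambda>f g x. f x - g x"
  by (simp add: bounded_clinear_def bounded_linear_sub complex_vector.scale_right_diff_distrib)

lift_definition times_bop :: "'a bop \<Rightarrow> 'a bop \<Rightarrow> 'a bop" is "\<lambda>f g x. f (g x)"
  by (simp add: bounded_clinear_def bounded_linear_compose)

instance
  by standard
    (transfer; simp add: bounded_clinear_def linear_simps algebra_simps)+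

end

definition nilpotent :: "'a::{ring, monoid_mult} \<Rightarrow> bool" where
  "nilpotent a \<longleftrightarrow> (\<exists>n. a ^ n = 0)"

definition nilpotency_index :: "'a::{ring, monoid_mult} \<Rightarrow> nat" where
  "nilpotency_index a = (LEAST n. a ^ n = 0)"

definition automorphism_of_order_3 :: "'a::chilbert_space bop \<Rightarrow> bool" where
  "automorphism_of_order_3 T \<longleftrightarrow> (\<exists>S. S * T = 1 \<and> T * S = 1) \<and> T ^ 3 = 1 \<and> T \<noteq> 1"

end

theory Submission
  imports Defs
begin

text \<open>
  An infinite-dimensional Hilbert space \<open>H\<close> is isometrically isomorphic to \<open>H \<oplus> H\<close>, hence to
  \<open>H \<oplus> H \<oplus> H\<close>, so every operator is a \<open>3 \<times> 3\<close> matrix with entries in \<open>B(H)\<close>. Fix scalars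
  \<open>a, b, c\<close>. A triangular matrix \<open>T\<close> whose diagonal consists of \<open>a, b, c\<close> satisfies
  \<open>(T - a)(T - b)(T - c) = 0\<close>, and so do its conjugates. For \<open>a = b = c = 0\<close> this is \<open>T\<^sup>3 = 0\<close>; for
  the three cube roots of unity it is \<open>T\<^sup>3 = 1\<close>. Both halves of the theorem therefore follow from one
  statement: every operator is a sum of four operators that are triangularizable with diagonal
  \<open>a, b, c\<close> (\<open>sum_of_four_triangularizable_operators\<close>).

  An upper and a lower triangular summand take care of everything off the diagonal. It remains to find
  two conjugates of triangular matrices whose sum has a prescribed diagonal, up to the contribution of
  \<open>a, b, c\<close>. Conjugating by elementary matrices produces the diagonal
  \<open>(xy, - yx - zu, uz)\<close>, up to that contribution, for arbitrary entries \<open>x, y, z, u\<close>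
  (\<open>triangularizable_with_diagonal\<close>). Moving \<open>xy\<close> to another place thus turns it into
  \<open>yx\<close>, and two such matrices can realise every diagonal as soon as every \<open>d\<close> in \<open>B(H)\<close> is a sum of two
  commutators.

  The latter is an Eilenberg swindle. Let \<open>v1, v2\<close> be the isometries that embed the two halves of
  \<open>H \<cong> H \<oplus> H\<close>, with adjoints \<open>w1, w2\<close>, and let \<open>F = d \<oplus> d \<oplus> d \<oplus> \<dots>\<close>, so that
  \<open>F = v1 d w1 + v2 F w2\<close> (\<open>exists_swindle\<close>). Then
  \<open>d = (w1 (v1 d) - (v1 d) w1) + (w2 (v2 F) - (v2 F) w2)\<close>, because the first commutator
  is \<open>d - v1 d w1\<close> and the second is \<open>F - v2 F w2\<close>.
\<close>

section \<open>Triangularizable elements of a ring\<close>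

definition orthogonal_idempotents :: "'r::{ring,monoid_mult} \<Rightarrow> 'r \<Rightarrow> 'r \<Rightarrow> bool" where
  "orthogonal_idempotents e f g \<longleftrightarrow> e * e = e \<and> f * f = f \<and> g * g = g \<and> e * f = 0 \<and> f * e = 0 \<and>
     e * g = 0 \<and> g * e = 0 \<and> f * g = 0 \<and> g * f = 0 \<and> e + f + g = 1"

lemma orthogonal_idempotents_permute:
  assumes "orthogonal_idempotents e f g"
  shows "orthogonal_idempotents g f e" "orthogonal_idempotents e g f"
  using assms by (auto simp: orthogonal_idempotents_def add_ac)

text \<open>
  For central \<open>a, b, c\<close> the three equations say that the Peirce decomposition of \<open>T\<close> with respect to
  \<open>e, f, g\<close> is upper triangular with \<open>a, b, c\<close> on the diagonal. Requiring \<open>f \<noteq> 0\<close> makes the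
  middle diagonal entry count: if \<open>a - b\<close> is invertible, then \<open>T\<close> cannot be the scalar \<open>a\<close>.
\<close>

definition triangularizable :: "'r::{ring,monoid_mult} \<Rightarrow> 'r \<Rightarrow> 'r \<Rightarrow> 'r \<Rightarrow> bool" where
  "triangularizable a b c T \<longleftrightarrow> (\<exists>e f g. orthogonal_idempotents e f g \<and> f \<noteq> 0 \<and>
     T * e = a * e \<and> f * T * f = b * f \<and> g * T = c * g)"

definition central :: "'r::{ring,monoid_mult} \<Rightarrow> bool" where
  "central a \<longleftrightarrow> (\<forall>x. a * x = x * a)"

text \<open>
  A Cayley-Hamilton argument along the flag: \<open>T - c\<close> maps into the range of \<open>e + f\<close>,
  \<open>T - b\<close> maps that into the range of \<open>e\<close>, and \<open>T - a\<close> kills the range of \<open>e\<close>.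
\<close>

lemma triangularizable_cubic:
  assumes a: "central a" and b: "central b" and c: "central c" and T: "triangularizable a b c T"
  shows "(T - a) * (T - b) * (T - c) = 0"
proof -
  obtain e f g where fr: "orthogonal_idempotents e f g" and Te: "T * e = a * e"
    and fTf: "f * T * f = b * f" and gT: "g * T = c * g"
    using T by (auto simp: triangularizable_def)
  note fr' = fr[unfolded orthogonal_idempotents_def]
  have comm: "e * a = a * e" "e * b = b * e" "g * c = c * g"
    using a b c by (simp_all add: central_def)
  have one: "e + f + g = 1" using fr' by blast
  have gTf: "g * T * f = 0" using gT fr' by (simp add: mult.assoc)
  have Tf: "T * f = e * T * f + b * f"
  proof -
    have "T * f = (e + f + g) * T * f" by (simp only: one mult_1_left)
    also have "\<dots> = e * T * f + f * T * f + g * T * f" by (simp only: distrib_right)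
    finally show ?thesis using gTf fTf by simp
  qed
  have 1: "(T - a) * e = 0" using Te by (simp add: left_diff_distrib)
  have 2: "(T - b) * (e + f) = e * (a - b + T * f)"
  proof -
    have "(T - b) * (e + f) = T * e + T * f - b * e - b * f"
      by (simp add: algebra_simps)
    also have "\<dots> = a * e + e * T * f - b * e" by (simp add: Te Tf)
    also have "\<dots> = e * (a - b + T * f)"
      by (simp add: distrib_left right_diff_distrib comm mult.assoc)
    finally show ?thesis .
  qed
  have 3: "T - c = (e + f) * (T - c)"
  proof -
    have "g * (T - c) = 0" using gT by (simp add: right_diff_distrib comm)
    then have "(e + f) * (T - c) = (e + f + g) * (T - c)" by (simp add: distrib_right)
    then show ?thesis by (simp add: one)
  qed
  have "(T - a) * (T - b) * (T - c) = (T - a) * ((T - b) * (e + f)) * (T - c)"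
    using 3 by (metis mult.assoc)
  also have "\<dots> = ((T - a) * e) * ((a - b + T * f) * (T - c))"
    by (simp only: 2 mult.assoc)
  finally show ?thesis by (simp add: 1)
qed

lemma triangularizable_conjugate:
  assumes T: "triangularizable a b c T" and P: "Q * P = 1" "P * Q = 1"
    and a: "central a" and b: "central b" and c: "central c"
  shows "triangularizable a b c (P * T * Q)"
proof -
  obtain e f g where fr: "orthogonal_idempotents e f g" and f0: "f \<noteq> 0" and Te: "T * e = a * e"
    and fTf: "f * T * f = b * f" and gT: "g * T = c * g"
    using T by (auto simp: triangularizable_def)
  have QP: "Q * (P * x) = x" for x using P(1) by (metis mult.assoc mult_1_left)
  define K where "K x = P * x * Q" for x
  have Km: "K x * K y = K (x * y)" for x y by (simp add: K_def mult.assoc QP)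
  have Ka: "K x + K y = K (x + y)" for x y by (simp add: K_def algebra_simps)
  have K1: "K 1 = 1" and K0: "K 0 = 0" using P by (simp_all add: K_def)
  have Kc: "z * K x = K (z * x)" if "central z" for x z
    using that unfolding K_def central_def by (metis mult.assoc)
  have "K f \<noteq> 0"
  proof
    assume "K f = 0"
    then have "Q * K f * P = 0" by simp
    then show False using f0 P by (simp add: K_def mult.assoc QP)
  qed
  moreover have "orthogonal_idempotents (K e) (K f) (K g)"
    using fr by (simp add: orthogonal_idempotents_def Km Ka K1 K0)
  moreover have "K T * K e = a * K e" "K f * K T * K f = b * K f" "K g * K T = c * K g"
    using Te fTf gT a b c by (simp_all add: Km Kc)
  ultimately show ?thesis unfolding triangularizable_def K_def by blast
qed

section \<open>Sums of triangularizable block matrices\<close>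

text \<open>
  The elements \<open>p\<^sub>i\<close> and \<open>q\<^sub>i\<close> are the inclusions and projections of a decomposition of the regular module
  into three copies of itself, that is, an isomorphism of the ring with its own
  \<open>3 \<times> 3\<close> matrices: \<open>q\<^sub>i * B * p\<^sub>j\<close> is the entry of \<open>B\<close> in row \<open>i\<close> and column \<open>j\<close>.
\<close>

locale blocks3 =
  fixes p1 p2 p3 q1 q2 q3 :: "'r::{ring,monoid_mult}"
  assumes qp [simp]: "q1 * p1 = 1" "q1 * p2 = 0" "q1 * p3 = 0"
    "q2 * p1 = 0" "q2 * p2 = 1" "q2 * p3 = 0"
    "q3 * p1 = 0" "q3 * p2 = 0" "q3 * p3 = 1"
    and pq: "p1 * q1 + p2 * q2 + p3 * q3 = 1"
    and nontrivial: "(1 :: 'r) \<noteq> 0"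
begin

lemma qp_cancel [simp]:
  "q1 * (p1 * x) = x" "q1 * (p2 * x) = 0" "q1 * (p3 * x) = 0"
  "q2 * (p1 * x) = 0" "q2 * (p2 * x) = x" "q2 * (p3 * x) = 0"
  "q3 * (p1 * x) = 0" "q3 * (p2 * x) = 0" "q3 * (p3 * x) = x"
  by (simp_all add: mult.assoc [symmetric])

lemma central_blocks:
  assumes "central z"
  shows "q1 * z = z * q1" "q2 * z = z * q2" "q3 * z = z * q3"
    "q1 * (z * x) = z * (q1 * x)" "q2 * (z * x) = z * (q2 * x)" "q3 * (z * x) = z * (q3 * x)"
    "p1 * (z * x) = z * (p1 * x)" "p2 * (z * x) = z * (p2 * x)" "p3 * (z * x) = z * (p3 * x)"
  using assms unfolding central_def by (metis mult.assoc)+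

lemma idempotents_blocks: "orthogonal_idempotents (p1 * q1) (p2 * q2) (p3 * q3)"
  using pq by (simp add: orthogonal_idempotents_def mult.assoc)

lemma block_nonzero: "p1 * q1 \<noteq> 0" "p2 * q2 \<noteq> 0" "p3 * q3 \<noteq> 0"
proof -
  have "q1 * (p1 * q1) * p1 = 1" "q2 * (p2 * q2) * p2 = 1" "q3 * (p3 * q3) * p3 = 1"
    by simp_all
  then show "p1 * q1 \<noteq> 0" "p2 * q2 \<noteq> 0" "p3 * q3 \<noteq> 0"
    using nontrivial by (metis mult_zero_left mult_zero_right)+
qed

lemma expand_blocks:
  "B = p1 * (q1 * B * p1) * q1 + p1 * (q1 * B * p2) * q2 + p1 * (q1 * B * p3) * q3
     + p2 * (q2 * B * p1) * q1 + p2 * (q2 * B * p2) * q2 + p2 * (q2 * B * p3) * q3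
     + p3 * (q3 * B * p1) * q1 + p3 * (q3 * B * p2) * q2 + p3 * (q3 * B * p3) * q3"
proof -
  have "B = (p1 * q1 + p2 * q2 + p3 * q3) * B * (p1 * q1 + p2 * q2 + p3 * q3)"
    by (simp only: pq mult_1_left mult_1_right)
  then show ?thesis by (simp add: distrib_left distrib_right mult.assoc add.assoc add_ac)
qed

text \<open>
  The entries above the diagonal go into \<open>T\<close> and those below it into \<open>S\<close>. Read from the last
  block to the first, \<open>S\<close> is upper triangular; its diagonal is \<open>a, b, c\<close> in that order, which is why the
  required diagonal of \<open>B\<close> is symmetric.
\<close>

lemma sum_of_two_triangularizable:
  assumes c: "central a" "central b" "central c"
    and d: "q1 * B * p1 = a + c" "q2 * B * p2 = b + b" "q3 * B * p3 = c + a"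
  shows "\<exists>T S. triangularizable a b c T \<and> triangularizable a b c S \<and> B = T + S"
proof -
  define T where "T = p1 * a * q1 + p2 * b * q2 + p3 * c * q3
     + p1 * (q1 * B * p2) * q2 + p1 * (q1 * B * p3) * q3 + p2 * (q2 * B * p3) * q3"
  define S where "S = p1 * c * q1 + p2 * b * q2 + p3 * a * q3
     + p2 * (q2 * B * p1) * q1 + p3 * (q3 * B * p1) * q1 + p3 * (q3 * B * p2) * q2"
  have "triangularizable a b c T"
    unfolding triangularizable_def using idempotents_blocks block_nonzero
    by (intro exI[of _ "p1 * q1"] exI[of _ "p2 * q2"] exI[of _ "p3 * q3"])
      (simp add: T_def distrib_left distrib_right mult.assoc c central_blocks)
  moreover have "triangularizable a b c S"
    unfolding triangularizable_def using orthogonal_idempotents_permute(1)[OF idempotents_blocks] block_nonzero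
    by (intro exI[of _ "p3 * q3"] exI[of _ "p2 * q2"] exI[of _ "p1 * q1"])
      (simp add: S_def distrib_left distrib_right mult.assoc c central_blocks)
  moreover have "B = T + S"
    by (subst expand_blocks) (simp add: T_def S_def d distrib_left distrib_right add_ac)
  ultimately show ?thesis by blast
qed

text \<open>
  Conjugating a triangular matrix by \<open>1 - Y\<close> with \<open>Y * Y = 0\<close> changes its diagonal by
  products of off-diagonal entries. Since the entries do not commute, the products added at
  one place and subtracted at another are the two different orders \<open>x * y\<close> and \<open>y * x\<close>.
\<close>

lemma triangularizable_with_diagonal:
  assumes c: "central a" "central b" "central c"
  shows "\<exists>T. triangularizable a b c T \<and> q1 * T * p1 = a + x * y \<and>
     q2 * T * p2 = c - y * x - z * u \<and> q3 * T * p3 = b + u * z"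
proof -
  \<comment> \<open>\<open>M\<close> is upper triangular for the block order 1, 3, 2, hence the positions of \<open>b\<close> and \<open>c\<close>.\<close>
  define M where "M = p1 * a * q1 + p3 * b * q3 + p2 * c * q2 + p1 * x * q2 + p3 * u * q2"
  define Y where "Y = p2 * y * q1 + p2 * z * q3"
  have YY: "Y * Y = 0" by (simp add: Y_def distrib_left distrib_right mult.assoc)
  have "triangularizable a b c M"
    unfolding triangularizable_def using orthogonal_idempotents_permute(2)[OF idempotents_blocks] block_nonzero
    by (intro exI[of _ "p1 * q1"] exI[of _ "p3 * q3"] exI[of _ "p2 * q2"])
      (simp add: M_def distrib_left distrib_right mult.assoc c central_blocks)
  then have "triangularizable a b c ((1 - Y) * M * (1 + Y))"
    using c by (intro triangularizable_conjugate)
      (simp_all add: distrib_left distrib_right left_diff_distrib right_diff_distrib YY)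
  moreover have "(1 - Y) * M * (1 + Y) = M + M * Y - Y * M - Y * M * Y"
    by (simp add: distrib_left left_diff_distrib)
  then have "q1 * ((1 - Y) * M * (1 + Y)) * p1 = a + x * y"
    "q2 * ((1 - Y) * M * (1 + Y)) * p2 = c - y * x - z * u"
    "q3 * ((1 - Y) * M * (1 + Y)) * p3 = b + u * z"
    by (simp_all add: M_def Y_def distrib_left distrib_right left_diff_distrib right_diff_distrib mult.assoc)
  ultimately show ?thesis by blast
qed

end

text \<open>
  A ring isomorphic to its own \<open>2 \<times> 2\<close> matrices, as \<open>B(H)\<close> is when \<open>H \<cong> H \<oplus> H\<close>.
\<close>

locale halving =
  fixes v1 v2 w1 w2 :: "'r::{ring,monoid_mult}"
  assumes wv [simp]: "w1 * v1 = 1" "w1 * v2 = 0" "w2 * v1 = 0" "w2 * v2 = 1"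
    and vw: "v1 * w1 + v2 * w2 = 1"
begin

lemma wv_cancel [simp]:
  "w1 * (v1 * x) = x" "w1 * (v2 * x) = 0" "w2 * (v1 * x) = 0" "w2 * (v2 * x) = x"
  by (simp_all add: mult.assoc [symmetric])

text \<open>
  Splitting the second half once more gives three copies.
\<close>

lemma blocks3_halving:
  assumes "(1 :: 'r) \<noteq> 0"
  shows "blocks3 v1 (v2 * v1) (v2 * v2) w1 (w1 * w2) (w2 * w2)"
proof
  have "v1 * w1 + v2 * v1 * (w1 * w2) + v2 * v2 * (w2 * w2)
     = v1 * w1 + v2 * (v1 * w1 + v2 * w2) * w2"
    by (simp add: distrib_left distrib_right mult.assoc)
  then show "v1 * w1 + v2 * v1 * (w1 * w2) + v2 * v2 * (w2 * w2) = 1"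
    by (simp add: vw)
qed (use assms in \<open>simp_all add: mult.assoc\<close>)

text \<open>
  After \<open>T3\<close> and \<open>T4\<close> have absorbed the diagonal of \<open>A\<close>, the rest is the sum of an
  upper and a lower triangular matrix. Conjugation changes the trace of a matrix only by commutators of
  entries, so the trace \<open>d\<close> of the diagonal that \<open>T3\<close> and \<open>T4\<close> have to realise must be a sum of
  commutators. The swindle hypothesis provides this.
\<close>

theorem sum_of_four_triangularizable:
  fixes A a b c :: 'r
  assumes ne: "(1 :: 'r) \<noteq> 0" and c: "central a" "central b" "central c"
    and swindle: "\<And>d. \<exists>F. F = v1 * d * w1 + v2 * F * w2"
  shows "\<exists>T1 T2 T3 T4. triangularizable a b c T1 \<and> triangularizable a b c T2 \<and>
    triangularizable a b c T3 \<and> triangularizable a b c T4 \<and> A = T1 + T2 + T3 + T4"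
proof -
  interpret blocks3 v1 "v2 * v1" "v2 * v2" w1 "w1 * w2" "w2 * w2"
    by (rule blocks3_halving[OF ne])
  \<comment> \<open>The diagonal of \<open>A\<close> minus the scalars that the four summands contribute.\<close>
  define A1 A2 A3 where "A1 = w1 * A * v1 - (a + c) - a - a"
    and "A2 = (w1 * w2) * A * (v2 * v1) - (b + b) - c - c"
    and "A3 = (w2 * w2) * A * (v2 * v2) - (c + a) - b - b"
  define d where "d = A1 + A2 + A3"
  obtain F where F: "F = v1 * d * w1 + v2 * F * w2" using swindle by blast
  \<comment> \<open>In \<open>T3\<close> the factors equal to 1 make the middle entry compensate \<open>A1 - F\<close> and \<open>A3 - d\<close>
    exactly. In \<open>T4\<close> the parts \<open>F = w2 (v2 F)\<close> and \<open>d = w1 (v1 d)\<close> left over in the outer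
    places are subtracted in the middle as \<open>v2 F w2\<close> and \<open>v1 d w1\<close>, whose sum is \<open>F\<close>. The middle entry of
    \<open>T3 + T4\<close> thus becomes \<open>- (A1 - F) - (A3 - d) - F = A2\<close>, up to scalars.\<close>
  obtain T3 where T3: "triangularizable a b c T3" "w1 * T3 * v1 = a + (A1 - F) * 1"
     "(w1 * w2) * T3 * (v2 * v1) = c - 1 * (A1 - F) - 1 * (A3 - d)"
     "(w2 * w2) * T3 * (v2 * v2) = b + (A3 - d) * 1"
    using triangularizable_with_diagonal[OF c] by blast
  obtain T4 where T4: "triangularizable a b c T4" "w1 * T4 * v1 = a + w2 * (v2 * F)"
     "(w1 * w2) * T4 * (v2 * v1) = c - v2 * F * w2 - v1 * d * w1"
     "(w2 * w2) * T4 * (v2 * v2) = b + w1 * (v1 * d)"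
    using triangularizable_with_diagonal[OF c] by blast
  define B where "B = A - T3 - T4"
  have "w1 * B * v1 = a + c"
    using T3(2) T4(2) by (simp add: B_def A1_def left_diff_distrib right_diff_distrib)
  moreover have "(w1 * w2) * B * (v2 * v1) = b + b"
  proof -
    have "(w1 * w2) * B * (v2 * v1) =
       (w1 * w2) * A * (v2 * v1) - (w1 * w2) * T3 * (v2 * v1) - (w1 * w2) * T4 * (v2 * v1)"
      by (simp only: B_def left_diff_distrib right_diff_distrib)
    also have "\<dots> = (A2 + (b + b) + c + c) - (c - 1 * (A1 - F) - 1 * (A3 - d))
        - (c - (v1 * d * w1 + v2 * F * w2))"
      by (simp add: T3 T4 A2_def)
    also have "\<dots> = b + b" unfolding F[symmetric] by (simp add: d_def)
    finally show ?thesis .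
  qed
  moreover have "(w2 * w2) * B * (v2 * v2) = c + a"
  proof -
    have "(w2 * w2) * B * (v2 * v2) =
       (w2 * w2) * A * (v2 * v2) - (w2 * w2) * T3 * (v2 * v2) - (w2 * w2) * T4 * (v2 * v2)"
      by (simp only: B_def left_diff_distrib right_diff_distrib)
    then show ?thesis by (simp add: T3 T4 A3_def)
  qed
  ultimately obtain T1 T2 where "triangularizable a b c T1" "triangularizable a b c T2" "B = T1 + T2"
    using sum_of_two_triangularizable[OF c] by blast
  then have "triangularizable a b c T1 \<and> triangularizable a b c T2 \<and>
    triangularizable a b c T3 \<and> triangularizable a b c T4 \<and> A = T1 + T2 + T3 + T4"
    using T3(1) T4(1) by (simp add: B_def algebra_simps)
  then show ?thesis by blast
qed

end

section \<open>Orthogonal sums of operators on a Hilbert space\<close>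

lemma cinner_zero_right [simp]: "cinner x 0 = 0"
  using cinner_scaleC_right[of x 0 0] by simp

lemma cinner_zero_left [simp]: "cinner 0 x = 0"
  by (subst cinner_commute) simp

lemma cinner_minus_right: "cinner x (- y) = - cinner x y"
  using cinner_add_right[of x y "- y"] by (simp add: add_eq_0_iff)

lemma cinner_diff_right: "cinner x (y - z) = cinner x y - cinner x z"
  using cinner_add_right[of x y "- z"] by (simp add: cinner_minus_right)

lemma cinner_add_left: "cinner (x + y) z = cinner x z + cinner y z"
  by (subst (1 2 3) cinner_commute) (simp add: cinner_add_right)

lemma cinner_scaleC_left: "cinner (c *\<^sub>C x) y = cnj c * cinner x y"
  by (subst (1 2) cinner_commute) (simp add: cinner_scaleC_right)

lemma cinner_diff_left: "cinner (x - y) z = cinner x z - cinner y z"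
  by (subst (1 2 3) cinner_commute) (simp add: cinner_diff_right)

lemma cinner_sum_right: "cinner x (\<Sum>i\<in>A. f i) = (\<Sum>i\<in>A. cinner x (f i))"
  by (induction A rule: infinite_finite_induct) (simp_all add: cinner_add_right)

lemma cinner_sum_left: "cinner (\<Sum>i\<in>A. f i) x = (\<Sum>i\<in>A. cinner (f i) x)"
  by (induction A rule: infinite_finite_induct) (simp_all add: cinner_add_left)

lemma cinner_self: "cinner x x = of_real ((norm x)\<^sup>2)"
  using cinner_ge_zero[of x] by (simp add: norm_eq_sqrt_cinner complex_eq_iff)

lemma norm_power2_cinner: "(norm x)\<^sup>2 = Re (cinner x x)"
  by (simp add: cinner_self)

lemma norm_scaleC: "norm (c *\<^sub>C x) = cmod c * norm x"
proof -
  have "complex_of_real ((norm (c *\<^sub>C x))\<^sup>2) = of_real ((cmod c * norm x)\<^sup>2)"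
    unfolding cinner_self[symmetric] cinner_scaleC_left cinner_scaleC_right
    by (simp add: cinner_self power_mult_distrib complex_norm_square ac_simps del: of_real_power)
  then have "(norm (c *\<^sub>C x))\<^sup>2 = (cmod c * norm x)\<^sup>2"
    using of_real_eq_iff by blast
  then show ?thesis by (simp add: power2_eq_iff_nonneg)
qed

lemma bounded_linear_scaleC: "bounded_linear (\<lambda>x :: 'a::chilbert_space. c *\<^sub>C x)"
  by (rule bounded_linear_intro[of _ "cmod c"])
    (auto simp: scaleC_add_right scaleR_scaleC scaleC_scaleC norm_scaleC mult.commute)

lemma cinner_normalized:
  assumes "x \<noteq> 0"
  defines "u \<equiv> complex_of_real (1 / norm x) *\<^sub>C x"
  shows "cinner u u = 1"
proof -
  have "cinner u u = of_real (1 / norm x * (1 / norm x)) * cinner x x"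
    by (simp add: u_def cinner_scaleC_left cinner_scaleC_right)
  then show ?thesis
    using assms(1) by (simp add: cinner_self power2_eq_square)
qed

lemma norm_sum_orthogonal:
  assumes "finite F" and "\<And>i j. i \<in> F \<Longrightarrow> j \<in> F \<Longrightarrow> i \<noteq> j \<Longrightarrow> cinner (f i) (f j) = 0"
  shows "(norm (\<Sum>i\<in>F. f i))\<^sup>2 = (\<Sum>i\<in>F. (norm (f i))\<^sup>2)"
proof -
  have "cinner (\<Sum>i\<in>F. f i) (\<Sum>i\<in>F. f i) = (\<Sum>i\<in>F. \<Sum>j\<in>F. cinner (f i) (f j))"
    by (simp only: cinner_sum_left) (simp only: cinner_sum_right)
  also have "\<dots> = (\<Sum>i\<in>F. \<Sum>j\<in>F. if i = j then cinner (f i) (f i) else 0)"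
    using assms(2) by (intro sum.cong) auto
  also have "\<dots> = (\<Sum>i\<in>F. cinner (f i) (f i))" using assms(1) by simp
  finally show ?thesis by (simp add: norm_power2_cinner)
qed

definition orthonormal :: "('i \<Rightarrow> 'a::chilbert_space) \<Rightarrow> 'i set \<Rightarrow> bool" where
  "orthonormal f A \<longleftrightarrow> (\<forall>i\<in>A. \<forall>j\<in>A. cinner (f i) (f j) = (if i = j then 1 else 0))"

lemma orthonormal_norm: "orthonormal f A \<Longrightarrow> i \<in> A \<Longrightarrow> norm (f i) = 1"
  by (simp add: orthonormal_def norm_eq_sqrt_cinner)

text \<open>
  The sum is the squared norm of the projection \<open>s\<close> of \<open>x\<close> to the span of the family, and \<open>x - s\<close>
  is orthogonal to \<open>s\<close>.
\<close>

lemma bessel_inequality: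
  assumes "orthonormal f F" "finite F"
  shows "(\<Sum>i\<in>F. (cmod (cinner (f i) x))\<^sup>2) \<le> (norm x)\<^sup>2"
proof -
  define s where "s = (\<Sum>i\<in>F. cinner (f i) x *\<^sub>C f i)"
  have s_coord: "cinner (f i) s = cinner (f i) x" if "i \<in> F" for i
  proof -
    have "cinner (f i) s = (\<Sum>j\<in>F. if j = i then cinner (f j) x else 0)"
      unfolding s_def cinner_sum_right using assms that
      by (intro sum.cong) (auto simp: cinner_scaleC_right orthonormal_def)
    then show ?thesis using assms that by simp
  qed
  have ss: "cinner s y = (\<Sum>i\<in>F. cnj (cinner (f i) x) * cinner (f i) y)" for y
    by (simp add: s_def cinner_sum_left cinner_scaleC_left)
  have "cinner s (x - s) = 0"
    unfolding ss by (simp add: cinner_diff_right s_coord)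
  moreover from this have "cinner (x - s) s = 0" by (subst cinner_commute) simp
  ultimately have "cinner x x = cinner s s + cinner (x - s) (x - s)"
    by (simp add: cinner_diff_left cinner_diff_right)
  then have "(norm s)\<^sup>2 \<le> (norm x)\<^sup>2"
    by (simp add: norm_power2_cinner) (metis norm_power2_cinner zero_le_power2)
  moreover have "(norm s)\<^sup>2 = (\<Sum>i\<in>F. (norm (cinner (f i) x *\<^sub>C f i))\<^sup>2)"
    unfolding s_def using assms
    by (intro norm_sum_orthogonal) (auto simp: cinner_scaleC_left cinner_scaleC_right orthonormal_def)
  moreover have "\<dots> = (\<Sum>i\<in>F. (cmod (cinner (f i) x))\<^sup>2)"
    using orthonormal_norm[OF assms(1)] by (simp add: norm_scaleC)
  ultimately show ?thesis by simp
qed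

text \<open>
  Bessel's inequality for the single unit vector \<open>x / norm x\<close>.
\<close>

lemma cauchy_schwarz: "cmod (cinner x y) \<le> norm x * norm y"
proof (cases "x = 0")
  case False
  define u where "u = complex_of_real (1 / norm x) *\<^sub>C x"
  have "cinner u u = 1" unfolding u_def by (rule cinner_normalized[OF False])
  then have "orthonormal (\<lambda>_. u) {()}" by (simp add: orthonormal_def)
  from bessel_inequality[OF this, of y] have "cmod (cinner u y) \<le> norm y"
    by (simp add: abs_le_square_iff[symmetric])
  then show ?thesis using False
    by (simp add: u_def cinner_scaleC_left norm_divide field_simps)
qed simp

lemma bounded_linear_cinner: "bounded_linear (cinner x)"
proof (rule bounded_linear_intro)
  show "norm (cinner x y) \<le> norm y * norm x" for y
    using cauchy_schwarz[of x y] by (simp add: mult.commute)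
qed (simp_all add: cinner_add_right scaleR_scaleC cinner_scaleC_right scaleR_conv_of_real)

lemma bop_apply_add [simp]: "bop_apply (S + T) x = bop_apply S x + bop_apply T x"
  by transfer simp
lemma bop_apply_zero [simp]: "bop_apply 0 x = 0"
  by transfer simp
lemma bop_apply_one [simp]: "bop_apply 1 x = x"
  by transfer simp
lemma bop_apply_mult [simp]: "bop_apply (S * T) x = bop_apply S (bop_apply T x)"
  by transfer simp

lemma bop_eqI: "(\<And>x. bop_apply S x = bop_apply T x) \<Longrightarrow> S = T"
  by transfer auto

lemma bounded_linear_bop: "bounded_linear (bop_apply T)"
  by transfer (simp add: bounded_clinear_def)

lemma bop_scaleC: "bop_apply T (c *\<^sub>C x) = c *\<^sub>C bop_apply T x"
  by transfer (simp add: bounded_clinear_def)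

text \<open>
  By the Pythagorean theorem the partial sums of \<open>f\<close> are as close to each other as those of
  the squared norms, so they form a Cauchy net because the latter converge.
\<close>

lemma summable_on_orthogonal:
  fixes f :: "'i \<Rightarrow> 'a::chilbert_space"
  assumes orth: "\<And>i j. i \<in> A \<Longrightarrow> j \<in> A \<Longrightarrow> i \<noteq> j \<Longrightarrow> cinner (f i) (f j) = 0"
    and bound: "\<And>F. finite F \<Longrightarrow> F \<subseteq> A \<Longrightarrow> (\<Sum>i\<in>F. (norm (f i))\<^sup>2) \<le> C"
  shows "f summable_on A"
proof -
  define g where "g = (\<lambda>i. (norm (f i))\<^sup>2)"
  have "g summable_on A"
    using bound by (intro nonneg_bdd_above_summable_on bdd_aboveI2[of _ _ C]) (auto simp: g_def)
  then have lim: "(sum g \<longlongrightarrow> infsum g A) (finite_subsets_at_top A)"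
    using summable_iff_has_sum_infsum has_sum_def by blast
  have "cauchy_filter (filtermap (sum f) (finite_subsets_at_top A))"
    unfolding cauchy_filter_def le_filter_def
  proof (intro allI impI)
    fix P :: "'a \<times> 'a \<Rightarrow> bool" assume "eventually P uniformity"
    then obtain e where e: "e > 0" "\<And>x y. dist x y < e \<Longrightarrow> P (x, y)"
      unfolding eventually_uniformity_metric by blast
    have "eventually (\<lambda>F. dist (sum g F) (infsum g A) < e\<^sup>2 / 16) (finite_subsets_at_top A)"
      using lim e(1) by (intro tendstoD) auto
    then obtain F0 where F0: "finite F0 \<and> F0 \<subseteq> A \<and> (\<forall>F. finite F \<and> F0 \<subseteq> F \<and> F \<subseteq> A \<longrightarrow>
        dist (sum g F) (infsum g A) < e\<^sup>2 / 16)"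
      unfolding eventually_finite_subsets_at_top by (rule exE)
    have near: "dist (sum f F) (sum f F0) < e / 2" if F: "finite F" "F0 \<subseteq> F" "F \<subseteq> A" for F
    proof -
      have "(dist (sum f F) (sum f F0))\<^sup>2 = (norm (sum f (F - F0)))\<^sup>2"
        using F F0 by (simp add: dist_norm sum_diff)
      also have "\<dots> = sum g (F - F0)"
        unfolding g_def using F by (intro norm_sum_orthogonal) (auto intro!: orth)
      also have "\<dots> = sum g F - sum g F0" using F F0 by (simp add: sum_diff)
      also have "\<dots> < (e / 2)\<^sup>2"
      proof -
        have "dist (sum g F) (infsum g A) < e\<^sup>2 / 16" "dist (sum g F0) (infsum g A) < e\<^sup>2 / 16"
          using F0 F by simp_all
        then show ?thesis by (simp add: dist_real_def power_divide abs_if split: if_splits)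
      qed
      finally show ?thesis using e(1) power_less_imp_less_base[of _ 2 "e / 2"] by simp
    qed
    have ev: "eventually (\<lambda>x. dist x (sum f F0) < e / 2) (filtermap (sum f) (finite_subsets_at_top A))"
      unfolding eventually_filtermap eventually_finite_subsets_at_top
      by (rule exI[of _ F0]) (use F0 near in simp)
    show "eventually P (filtermap (sum f) (finite_subsets_at_top A) \<times>\<^sub>F filtermap (sum f) (finite_subsets_at_top A))"
      unfolding eventually_prod_filter
      by (rule exI, rule exI, rule conjI[OF ev], rule conjI[OF ev])
        (intro allI impI e(2), erule (1) dist_triangle_half_l)
  qed
  moreover have "complete (UNIV :: 'a set)"
    by (meson Cauchy_convergent UNIV_I complete_def convergent_def)
  ultimately obtain x where "filtermap (sum f) (finite_subsets_at_top A) \<le> nhds x"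
    using cauchy_filter_complete_converges[of "filtermap (sum f) (finite_subsets_at_top A)" UNIV]
    by (auto simp: filtermap_bot_iff)
  then show ?thesis by (auto simp: summable_on_def has_sum_def filterlim_def)
qed

text \<open>
  Both infinite constructions below, the isometries \<open>v1, v2\<close> with their adjoints and the swindle
  operator \<open>F\<close>, are sums of operators that converge pointwise but in general not in norm. The
  values at each vector are orthogonal, which gives both convergence and the bound on the norm.
\<close>

lemma orthogonal_sum_of_operators:
  fixes L :: "'i \<Rightarrow> 'a::chilbert_space bop"
  assumes orth: "\<And>i j x. i \<in> A \<Longrightarrow> j \<in> A \<Longrightarrow> i \<noteq> j \<Longrightarrow> cinner (bop_apply (L i) x) (bop_apply (L j) x) = 0"
    and bound: "\<And>F x. finite F \<Longrightarrow> F \<subseteq> A \<Longrightarrow> (\<Sum>i\<in>F. (norm (bop_apply (L i) x))\<^sup>2) \<le> (C * norm x)\<^sup>2"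
    and C: "C \<ge> 0"
  shows "\<exists>T. \<forall>x. ((\<lambda>i. bop_apply (L i) x) has_sum bop_apply T x) A"
proof -
  define t where "t x = (\<Sum>\<^sub>\<infinity>i\<in>A. bop_apply (L i) x)" for x
  have t: "((\<lambda>i. bop_apply (L i) x) has_sum t x) A" for x
    unfolding t_def using orth bound
    by (intro has_sum_infsum summable_on_orthogonal) blast+
  have t_scaleC: "t (c *\<^sub>C x) = c *\<^sub>C t x" for c x
  proof -
    from has_sum_bounded_linear[OF bounded_linear_scaleC t] show ?thesis
      by (intro has_sum_unique[OF t]) (simp add: bop_scaleC)
  qed
  have t_norm: "norm (t x) \<le> norm x * C" for x
  proof -
    have "((\<lambda>F. norm (\<Sum>i\<in>F. bop_apply (L i) x)) \<longlongrightarrow> norm (t x)) (finite_subsets_at_top A)"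
      using t[of x] unfolding has_sum_def by (rule tendsto_norm)
    then show ?thesis
    proof (rule tendsto_upperbound)
      show "\<forall>\<^sub>F F in finite_subsets_at_top A. norm (\<Sum>i\<in>F. bop_apply (L i) x) \<le> norm x * C"
      proof (rule eventually_finite_subsets_at_top_weakI)
        fix F assume F: "finite F" "F \<subseteq> A"
        have "(norm (\<Sum>i\<in>F. bop_apply (L i) x))\<^sup>2 \<le> (C * norm x)\<^sup>2"
          using bound[OF F, of x] F by (subst norm_sum_orthogonal) (auto intro!: orth)
        then show "norm (\<Sum>i\<in>F. bop_apply (L i) x) \<le> norm x * C"
          using C by (simp add: power2_le_iff_abs_le mult.commute)
      qed
    qed simp
  qed
  have "bounded_clinear t"
    unfolding bounded_clinear_def
  proof (intro conjI allI bounded_linear_intro[of _ C])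
    show "t (x + y) = t x + t y" for x y
      using has_sum_add[OF t[of x] t[of y]]
      by (intro has_sum_unique[OF t]) (simp add: linear_simps(1)[OF bounded_linear_bop])
  qed (auto simp: scaleR_scaleC t_scaleC t_norm)
  then have "bop_apply (Bop t) = t" by (simp add: Bop_inverse)
  then show ?thesis using t by metis
qed

lift_definition rank_one :: "'a \<Rightarrow> 'a \<Rightarrow> 'a::chilbert_space bop" is "\<lambda>g f x. cinner f x *\<^sub>C g"
  unfolding bounded_clinear_def
proof (intro conjI allI)
  fix f g :: 'a
  show "bounded_linear (\<lambda>x. cinner f x *\<^sub>C g)"
  proof (rule bounded_linear_intro)
    show "norm (cinner f x *\<^sub>C g) \<le> norm x * (norm f * norm g)" for x
      using mult_right_mono[OF cauchy_schwarz norm_ge_zero, of f x g]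
      by (simp add: norm_scaleC ac_simps)
  qed (simp_all add: cinner_add_right scaleC_add_left scaleR_scaleC scaleC_scaleC cinner_scaleC_right)
qed (simp add: cinner_scaleC_right scaleC_scaleC)

text \<open>
  \<open>T\<close> is the partial isometry that sends \<open>f i\<close> to \<open>g i\<close> and vanishes on the orthogonal
  complement of the \<open>f i\<close>, if both families are orthonormal.
\<close>

definition transports :: "'i set \<Rightarrow> ('i \<Rightarrow> 'a) \<Rightarrow> ('i \<Rightarrow> 'a) \<Rightarrow> 'a::chilbert_space bop \<Rightarrow> bool" where
  "transports A f g T \<longleftrightarrow> (\<forall>x. ((\<lambda>i. cinner (f i) x *\<^sub>C g i) has_sum bop_apply T x) A)"

lemma exists_transport:
  fixes f g :: "'i \<Rightarrow> 'a::chilbert_space"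
  assumes f: "orthonormal f A" and g: "orthonormal g A"
  shows "\<exists>T. transports A f g T"
proof -
  have [simp]: "bop_apply (rank_one u v) x = cinner v x *\<^sub>C u" for u v x :: 'a
    by transfer simp
  have "\<exists>T. \<forall>x. ((\<lambda>i. bop_apply (rank_one (g i) (f i)) x) has_sum bop_apply T x) A"
  proof (rule orthogonal_sum_of_operators[where C = 1])
    fix F x assume F: "finite F" "F \<subseteq> A"
    then have "orthonormal f F" using f by (simp add: orthonormal_def subset_iff)
    moreover have "norm (g i) = 1" if "i \<in> F" for i using that F orthonormal_norm[OF g] by blast
    ultimately show "(\<Sum>i\<in>F. (norm (bop_apply (rank_one (g i) (f i)) x))\<^sup>2) \<le> (1 * norm x)\<^sup>2"
      using bessel_inequality[of f F x] F by (simp add: norm_scaleC)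
  qed (use g in \<open>auto simp: orthonormal_def cinner_scaleC_left cinner_scaleC_right\<close>)
  then show ?thesis by (simp add: transports_def)
qed

section \<open>Splitting an infinite-dimensional Hilbert space into two copies of itself\<close>

definition orthonormal_basis :: "'a::chilbert_space set \<Rightarrow> bool" where
  "orthonormal_basis E \<longleftrightarrow> orthonormal (\<lambda>e. e) E \<and> (\<forall>x. (\<forall>e\<in>E. cinner e x = 0) \<longrightarrow> x = 0)"

text \<open>
  Zorn's lemma gives a maximal orthonormal set. A nonzero vector orthogonal to it could be normalized and
  added.
\<close>

lemma exists_orthonormal_basis: "\<exists>E :: 'a::chilbert_space set. orthonormal_basis E"
proof -
  have "\<exists>E\<in>{E. orthonormal (\<lambda>e :: 'a. e) E}. \<forall>X\<in>{E. orthonormal (\<lambda>e. e) E}. E \<subseteq> X \<longrightarrow> X = E"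
  proof (rule subset_Zorn')
    fix \<C> assume C: "subset.chain {E. orthonormal (\<lambda>e :: 'a. e) E} \<C>"
    have "cinner x y = (if x = y then 1 else 0)" if xy: "x \<in> \<Union>\<C>" "y \<in> \<Union>\<C>" for x y
    proof -
      from xy obtain X Y where XY: "X \<in> \<C>" "x \<in> X" "Y \<in> \<C>" "y \<in> Y" by blast
      then have "X \<subseteq> Y \<or> Y \<subseteq> X" using C by (auto simp: subset.chain_def)
      then obtain Z where "Z \<in> \<C>" "x \<in> Z" "y \<in> Z" using XY by blast
      moreover then have "orthonormal (\<lambda>e. e) Z" using C by (auto simp: subset.chain_def)
      ultimately show ?thesis by (simp add: orthonormal_def)
    qed
    then show "\<Union>\<C> \<in> {E. orthonormal (\<lambda>e. e) E}" unfolding orthonormal_def by blast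
  qed
  then obtain E :: "'a set" where E: "orthonormal (\<lambda>e. e) E"
    and max: "\<And>X. orthonormal (\<lambda>e. e) X \<Longrightarrow> E \<subseteq> X \<Longrightarrow> X = E" by blast
  have "x = 0" if x: "\<forall>e\<in>E. cinner e x = 0" for x
  proof (rule ccontr)
    assume "x \<noteq> 0"
    define u where "u = complex_of_real (1 / norm x) *\<^sub>C x"
    have u1: "cinner u u = 1" unfolding u_def by (rule cinner_normalized[OF \<open>x \<noteq> 0\<close>])
    have "cinner e u = 0" "cinner u e = 0" if "e \<in> E" for e
      using x that cinner_commute[of x e]
      by (simp_all add: u_def cinner_scaleC_left cinner_scaleC_right)
    then have "orthonormal (\<lambda>e. e) (insert u E)"
      using E u1 by (auto simp: orthonormal_def)
    then have "u \<in> E" using max[of "insert u E"] by blast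
    then show False using \<open>\<And>e. e \<in> E \<Longrightarrow> cinner e u = 0\<close>[of u] u1 by simp
  qed
  then show ?thesis using E unfolding orthonormal_basis_def by blast
qed

lemma orthonormal_basis_eqI:
  assumes "orthonormal_basis E" "\<And>e. e \<in> E \<Longrightarrow> cinner e x = cinner e y"
  shows "x = y"
proof -
  have "\<forall>e\<in>E. cinner e (x - y) = 0" using assms(2) by (simp add: cinner_diff_right)
  then have "x - y = 0" using assms(1) unfolding orthonormal_basis_def by blast
  then show ?thesis by simp
qed

lemma infinite_orthonormal_basis:
  fixes E :: "'a::chilbert_space set"
  assumes inf: "infinite_cdim TYPE('a)" and E: "orthonormal_basis E"
  shows "infinite E"
proof
  assume fin: "finite E"
  have "x \<in> cspan E" for x
  proof -
    have "x = (\<Sum>e\<in>E. cinner e x *\<^sub>C e)"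
    proof (rule orthonormal_basis_eqI[OF E])
      fix e assume e: "e \<in> E"
      have "cinner e (\<Sum>f\<in>E. cinner f x *\<^sub>C f) = (\<Sum>f\<in>E. if f = e then cinner f x else 0)"
        unfolding cinner_sum_right using E e
        by (intro sum.cong) (auto simp: cinner_scaleC_right orthonormal_basis_def orthonormal_def)
      then show "cinner e x = cinner e (\<Sum>e\<in>E. cinner e x *\<^sub>C e)" using fin e by simp
    qed
    moreover have "(\<Sum>e\<in>E. cinner e x *\<^sub>C e) \<in> cspan E"
      by (intro complex_vector.span_sum complex_vector.span_scale complex_vector.span_base)
    ultimately show ?thesis by simp
  qed
  then show False using inf fin unfolding infinite_cdim_def by blast
qed

text \<open>
  An infinite set is equipotent with the disjoint union of two copies of itself.
\<close>

lemma infinite_split: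
  assumes "infinite E"
  obtains s1 s2 where "inj_on s1 E" "inj_on s2 E" "s1 ` E \<inter> s2 ` E = {}" "s1 ` E \<union> s2 ` E = E"
proof -
  have "(card_of (E <+> E), card_of E) \<in> ordIso" using assms by (intro card_of_Plus_infinite1 card_of_mono1) auto
  then obtain h where h: "bij_betw h (E <+> E) E" using card_of_ordIso by blast
  show thesis
  proof
    show "inj_on (h \<circ> Inl) E" "inj_on (h \<circ> Inr) E"
      using h by (auto simp: bij_betw_def inj_on_def)
    show "(h \<circ> Inl) ` E \<inter> (h \<circ> Inr) ` E = {}"
      using h by (auto simp: bij_betw_def inj_on_def)
    show "(h \<circ> Inl) ` E \<union> (h \<circ> Inr) ` E = E"
      using h by (auto simp: bij_betw_def)
  qed
qed

lemma transports_cinner: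
  assumes "transports A f g T"
  shows "((\<lambda>i. cinner (f i) x * cinner y (g i)) has_sum cinner y (bop_apply T x)) A"
proof -
  have "((\<lambda>i. cinner (f i) x *\<^sub>C g i) has_sum bop_apply T x) A"
    using assms by (simp add: transports_def)
  from has_sum_bounded_linear[OF bounded_linear_cinner this] show ?thesis
    by (simp add: cinner_scaleC_right)
qed

definition is_adjoint :: "'a::chilbert_space bop \<Rightarrow> 'a bop \<Rightarrow> bool" where
  "is_adjoint v w \<longleftrightarrow> (\<forall>x y. cinner (bop_apply v x) y = cinner x (bop_apply w y))"

lemma transports_adjoint:
  assumes "transports A f g T" "transports A g f S"
  shows "is_adjoint T S"
  unfolding is_adjoint_def
proof (intro allI)
  fix x y
  have "((\<lambda>i. cnj (cinner (f i) x * cinner y (g i))) has_sum cnj (cinner y (bop_apply T x))) A"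
    using transports_cinner[OF assms(1)] by (simp only: has_sum_cnj_iff)
  moreover have "cnj (cinner (f i) x * cinner y (g i)) = cinner (g i) y * cinner x (f i)" for i
    using cinner_commute[of x "f i"] cinner_commute[of "g i" y] by simp
  ultimately have "((\<lambda>i. cinner (g i) y * cinner x (f i)) has_sum cinner (bop_apply T x) y) A"
    using cinner_commute[of "bop_apply T x" y] by simp
  then show "cinner (bop_apply T x) y = cinner x (bop_apply S y)"
    by (rule has_sum_unique) (rule transports_cinner[OF assms(2)])
qed

lemma transports_orthogonal:
  assumes "transports A f g T" "\<And>i. i \<in> A \<Longrightarrow> cinner y (g i) = 0"
  shows "cinner y (bop_apply T x) = 0"
proof (rule has_sum_unique[OF transports_cinner[OF assms(1)]])
  show "((\<lambda>i. cinner (f i) x * cinner y (g i)) has_sum 0) A"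
    using assms(2) by (intro has_sum_0) simp
qed

lemma transports_coordinate:
  assumes "transports A f g T" "orthonormal g A" "j \<in> A"
  shows "cinner (g j) (bop_apply T x) = cinner (f j) x"
proof (rule has_sum_unique[OF transports_cinner[OF assms(1)]])
  show "((\<lambda>i. cinner (f i) x * cinner (g j) (g i)) has_sum cinner (f j) x) A"
    using assms(2,3) by (intro has_sum_finite_neutralI[of "{j}"]) (auto simp: orthonormal_def)
qed

text \<open>
  Split an orthonormal basis \<open>E\<close> into two halves equipotent with \<open>E\<close>. The isometries \<open>v1\<close> and
  \<open>v2\<close> carry \<open>E\<close> to the two halves, and all identities can be read off from coordinates.
\<close>

lemma exists_halving:
  assumes "infinite_cdim TYPE('a::chilbert_space)"
  obtains v1 v2 w1 w2 :: "'a::chilbert_space bop"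
  where "halving v1 v2 w1 w2" "is_adjoint v1 w1" "is_adjoint v2 w2"
proof -
  obtain E :: "'a set" where E: "orthonormal_basis E" using exists_orthonormal_basis by blast
  obtain s1 s2 where s: "inj_on s1 E" "inj_on s2 E" "s1 ` E \<inter> s2 ` E = {}" "s1 ` E \<union> s2 ` E = E"
    using infinite_split[OF infinite_orthonormal_basis[OF assms E]] .
  have oE: "orthonormal (\<lambda>e. e) E" using E by (simp add: orthonormal_basis_def)
  have sE: "s1 e \<in> E" "s2 e \<in> E" if "e \<in> E" for e using s(4) that by blast+
  have ortho: "cinner x y = (if x = y then 1 else 0)" if "x \<in> E" "y \<in> E" for x y
    using oE that by (simp add: orthonormal_def)
  have o1: "orthonormal s1 E" and o2: "orthonormal s2 E"
    by (simp_all add: orthonormal_def ortho sE inj_on_eq_iff[OF s(1)] inj_on_eq_iff[OF s(2)])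
  have o12: "cinner (s1 e) (s2 f) = 0" "cinner (s2 e) (s1 f) = 0" if "e \<in> E" "f \<in> E" for e f
  proof -
    have "s1 e \<noteq> s2 f" "s2 e \<noteq> s1 f" using s(3) that by blast+
    then show "cinner (s1 e) (s2 f) = 0" "cinner (s2 e) (s1 f) = 0" using that by (simp_all add: ortho sE)
  qed
  obtain v1 where v1: "transports E (\<lambda>e. e) s1 v1" using exists_transport[OF oE o1] ..
  obtain v2 where v2: "transports E (\<lambda>e. e) s2 v2" using exists_transport[OF oE o2] ..
  obtain w1 where w1: "transports E s1 (\<lambda>e. e) w1" using exists_transport[OF o1 oE] ..
  obtain w2 where w2: "transports E s2 (\<lambda>e. e) w2" using exists_transport[OF o2 oE] ..
  note coord = transports_coordinate[OF v1 o1] transports_coordinate[OF v2 o2]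
    transports_coordinate[OF w1 oE] transports_coordinate[OF w2 oE]
  have zero: "cinner (s2 e) (bop_apply v1 x) = 0" "cinner (s1 e) (bop_apply v2 x) = 0" if "e \<in> E" for e x
    by (rule transports_orthogonal[OF v1] transports_orthogonal[OF v2], simp add: o12 that)+
  have "halving v1 v2 w1 w2"
  proof
    show "w1 * v1 = 1" "w1 * v2 = 0" "w2 * v1 = 0" "w2 * v2 = 1"
      by (rule bop_eqI, rule orthonormal_basis_eqI[OF E], simp add: coord zero)+
    show "v1 * w1 + v2 * w2 = 1"
    proof (rule bop_eqI, rule orthonormal_basis_eqI[OF E])
      fix x e assume "e \<in> E"
      then consider f where "f \<in> E" "e = s1 f" | f where "f \<in> E" "e = s2 f" using s(4) by blast
      then show "cinner e (bop_apply (v1 * w1 + v2 * w2) x) = cinner e (bop_apply 1 x)"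
        by cases (simp_all add: cinner_add_right coord zero)
    qed
  qed
  then show thesis
    by (rule that) (rule transports_adjoint[OF v1 w1] transports_adjoint[OF v2 w2])+
qed

text \<open>
  The ranges of the isometries \<open>v2\<^sup>n v1\<close> for different \<open>n\<close> are orthogonal, and \<open>F\<close> acts as a copy of
  \<open>d\<close> on each of them: it is the sum of \<open>L n = v2\<^sup>n v1 d w1 w2\<^sup>n\<close> over all \<open>n\<close>. Dropping the first
  term and conjugating the rest back by \<open>v2, w2\<close> reproduces \<open>F\<close>.
\<close>

lemma exists_swindle:
  fixes d :: "'a::chilbert_space bop"
  assumes "halving v1 v2 w1 w2"
    and "is_adjoint v1 w1" "is_adjoint v2 w2"
  shows "\<exists>F. F = v1 * d * w1 + v2 * F * w2"
proof -
  interpret halving v1 v2 w1 w2 by fact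
  have adj1: "cinner (bop_apply v1 x) y = cinner x (bop_apply w1 y)"
    and adj2: "cinner (bop_apply v2 x) y = cinner x (bop_apply w2 y)" for x y
    using assms(2,3) by (simp_all add: is_adjoint_def)
  define L where "L n = v2 ^ n * v1 * d * w1 * w2 ^ n" for n
  have adj: "cinner (bop_apply (v2 ^ n) x) y = cinner x (bop_apply (w2 ^ n) y)" for n x y
  proof (induction n arbitrary: x y)
    case (Suc n)
    have "v2 ^ Suc n = v2 * v2 ^ n" "w2 ^ Suc n = w2 ^ n * w2" by (rule power_Suc, rule power_Suc2)
    then show ?case by (simp only: bop_apply_mult adj2 Suc.IH)
  qed simp
  have wv_pow: "w2 ^ n * v2 ^ (n + k) = v2 ^ k" for n k
  proof (induction n)
    case (Suc n)
    have "w2 ^ Suc n * v2 ^ (Suc n + k) = w2 ^ n * w2 * (v2 * v2 ^ (n + k))"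
      by (subst power_Suc2) simp
    then show ?case using Suc.IH by (simp add: mult.assoc)
  qed simp
  have L_adj: "cinner (bop_apply (L n) x) y = cinner (bop_apply (d * w1 * w2 ^ n) x) (bop_apply (w1 * w2 ^ n) y)"
    for n x y by (simp add: L_def adj adj1)
  have orth: "cinner (bop_apply (L i) x) (bop_apply (L j) x) = 0" if ij: "i < j" for i j x
  proof -
    obtain k where k: "j = i + Suc k" using less_imp_Suc_add[OF ij] by auto
    have "w1 * w2 ^ i * L j = w1 * (w2 ^ i * v2 ^ (i + Suc k)) * (v1 * d * w1 * w2 ^ j)"
      by (simp only: L_def k mult.assoc)
    also have "\<dots> = 0" unfolding wv_pow by (simp add: mult.assoc)
    finally show ?thesis by (simp only: L_adj flip: bop_apply_mult) simp
  qed
  have split: "(norm x)\<^sup>2 = (norm (bop_apply w1 x))\<^sup>2 + (norm (bop_apply w2 x))\<^sup>2" for x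
  proof -
    have "cinner x x = cinner x (bop_apply (v1 * w1 + v2 * w2) x)" by (simp only: vw bop_apply_one)
    also have "\<dots> = cnj (cinner (bop_apply v1 (bop_apply w1 x)) x) + cnj (cinner (bop_apply v2 (bop_apply w2 x)) x)"
      by (simp add: cinner_add_right flip: cinner_commute)
    finally show ?thesis by (simp add: adj1 adj2 norm_power2_cinner)
  qed
  \<comment> \<open>Bessel's inequality for the ranges of the \<open>v2\<^sup>n v1\<close>, with the remainder made explicit.\<close>
  have tele: "(\<Sum>n<N. (norm (bop_apply (w1 * w2 ^ n) x))\<^sup>2) + (norm (bop_apply (w2 ^ N) x))\<^sup>2 = (norm x)\<^sup>2" for N x
  proof (induction N)
    case (Suc N)
    then show ?case using split[of "bop_apply (w2 ^ N) x"] by simp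
  qed simp
  obtain K where K: "K \<ge> 0" "\<And>x. norm (bop_apply d x) \<le> norm x * K"
    using bounded_linear.nonneg_bounded[OF bounded_linear_bop] by blast
  have L_norm: "(norm (bop_apply (L n) x))\<^sup>2 \<le> K\<^sup>2 * (norm (bop_apply (w1 * w2 ^ n) x))\<^sup>2" for n x
  proof -
    have "w1 * w2 ^ n * L n = w1 * (w2 ^ n * v2 ^ (n + 0)) * (v1 * d * w1 * w2 ^ n)"
      by (simp add: L_def mult.assoc)
    also have "\<dots> = d * w1 * w2 ^ n" unfolding wv_pow by (simp add: mult.assoc)
    finally have "cinner (bop_apply (L n) x) (bop_apply (L n) x)
      = cinner (bop_apply (d * w1 * w2 ^ n) x) (bop_apply (d * w1 * w2 ^ n) x)"
      by (simp only: L_adj flip: bop_apply_mult)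
    then have "norm (bop_apply (L n) x) = norm (bop_apply d (bop_apply (w1 * w2 ^ n) x))"
      by (simp add: norm_eq_sqrt_cinner)
    also have "\<dots> \<le> K * norm (bop_apply (w1 * w2 ^ n) x)" using K(2) by (simp add: mult.commute)
    finally show ?thesis by (metis norm_ge_zero power_mono power_mult_distrib)
  qed
  have "\<exists>T. \<forall>x. ((\<lambda>n. bop_apply (L n) x) has_sum bop_apply T x) UNIV"
  proof (rule orthogonal_sum_of_operators)
    show "cinner (bop_apply (L i) x) (bop_apply (L j) x) = 0" if "i \<noteq> j" for i j x
      using that orth[of i j x] orth[of j i x] cinner_commute[of "bop_apply (L i) x" "bop_apply (L j) x"]
      by (cases i j rule: linorder_cases) simp_all
    show "(\<Sum>n\<in>F. (norm (bop_apply (L n) x))\<^sup>2) \<le> (K * norm x)\<^sup>2" if "finite F" for F x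
    proof -
      obtain N where N: "F \<subseteq> {..<N}" using \<open>finite F\<close> finite_nat_iff_bounded by blast
      have "(\<Sum>n\<in>F. (norm (bop_apply (L n) x))\<^sup>2) \<le> (\<Sum>n<N. (norm (bop_apply (L n) x))\<^sup>2)"
        using N by (intro sum_mono2) auto
      also have "\<dots> \<le> (\<Sum>n<N. K\<^sup>2 * (norm (bop_apply (w1 * w2 ^ n) x))\<^sup>2)"
        using L_norm by (intro sum_mono)
      also have "\<dots> \<le> K\<^sup>2 * (norm x)\<^sup>2"
        unfolding sum_distrib_left[symmetric] tele[of x N, symmetric]
        by (intro mult_left_mono) simp_all
      finally show ?thesis by (simp add: power_mult_distrib)
    qed
  qed (use K in auto)
  then obtain F where "\<And>x. ((\<lambda>n. bop_apply (L n) x) has_sum bop_apply F x) UNIV" by blast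
  then have F: "(\<lambda>n. bop_apply (L n) x) sums bop_apply F x" for x by (rule has_sum_imp_sums)
  have "F = v1 * d * w1 + v2 * F * w2"
  proof (rule bop_eqI)
    fix x
    have "L (Suc n) = v2 * L n * w2" for n by (simp add: L_def mult.assoc power_commutes)
    moreover have "(\<lambda>n. bop_apply v2 (bop_apply (L n) (bop_apply w2 x))) sums bop_apply v2 (bop_apply F (bop_apply w2 x))"
      using F by (rule bounded_linear.sums[OF bounded_linear_bop])
    ultimately have "(\<lambda>n. bop_apply (L (Suc n)) x) sums bop_apply (v2 * F * w2) x" by simp
    then have "(\<lambda>n. bop_apply (L n) x) sums (bop_apply (v2 * F * w2) x + bop_apply (L 0) x)"
      by (rule sums_Suc)
    from sums_unique2[OF F this] show "bop_apply F x = bop_apply (v1 * d * w1 + v2 * F * w2) x"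
      by (simp add: L_def add.commute)
  qed
  then show ?thesis by blast
qed

section \<open>Sums of four nilpotent operators and of four automorphisms of order 3\<close>

lift_definition scalar :: "complex \<Rightarrow> 'a::chilbert_space bop" is "\<lambda>c x. c *\<^sub>C x"
  by (simp add: bounded_clinear_def bounded_linear_scaleC scaleC_scaleC mult.commute)

lemma central_scalar: "central (scalar c)"
  unfolding central_def by (intro allI bop_eqI) (simp add: scalar.rep_eq bop_scaleC)

lemma scalar_simps: "scalar 0 = 0" "scalar 1 = 1" "scalar c * scalar d = scalar (c * d)"
  "scalar c + scalar d = scalar (c + d)"
  by (rule bop_eqI, simp add: scalar.rep_eq scaleC_scaleC scaleC_one scaleC_add_left)+

theorem sum_of_four_triangularizable_operators:
  fixes A :: "'a::chilbert_space bop"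
  assumes "infinite_cdim TYPE('a)"
  shows "\<exists>Ts. length Ts = 4 \<and> (\<forall>T \<in> set Ts. triangularizable (scalar a) (scalar b) (scalar c) T) \<and>
    A = sum_list Ts"
proof -
  obtain v1 v2 w1 w2 :: "'a bop" where h: "halving v1 v2 w1 w2"
    and adj: "is_adjoint v1 w1" "is_adjoint v2 w2"
    using exists_halving[OF assms] .
  have "(1 :: 'a bop) \<noteq> 0"
  proof
    assume "(1 :: 'a bop) = 0"
    then have "bop_apply 1 x = bop_apply 0 x" for x :: 'a by (rule arg_cong)
    then have "x \<in> cspan {}" for x :: 'a using complex_vector.span_zero[of "{}"] by simp
    then have "finite {} \<and> cspan {} = (UNIV :: 'a set)" by blast
    then show False using assms unfolding infinite_cdim_def by blast
  qed
  from halving.sum_of_four_triangularizable[OF h this central_scalar central_scalar central_scalar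
      exists_swindle[OF h adj]]
  obtain T1 T2 T3 T4 where "triangularizable (scalar a) (scalar b) (scalar c) T1"
    "triangularizable (scalar a) (scalar b) (scalar c) T2"
    "triangularizable (scalar a) (scalar b) (scalar c) T3"
    "triangularizable (scalar a) (scalar b) (scalar c) T4" "A = T1 + T2 + T3 + T4"
    by metis
  then show ?thesis by (intro exI[of _ "[T1, T2, T3, T4]"]) (simp add: add.assoc)
qed

lemma nilpotent_of_triangularizable:
  assumes "triangularizable (scalar 0) (scalar 0) (scalar 0) N"
  shows "nilpotent N \<and> nilpotency_index N \<le> 3"
proof -
  have "N ^ 3 = 0"
    using triangularizable_cubic[OF central_scalar central_scalar central_scalar assms]
    by (simp add: scalar_simps power3_eq_cube)
  then show ?thesis unfolding nilpotent_def nilpotency_index_def by (auto intro: Least_le)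
qed

text \<open>
  The cubic equation is \<open>(T - 1)(T - w)(T - w\<^sup>2) = T\<^sup>3 - 1 = 0\<close>. If \<open>T\<close> were 1, the middle diagonal
  entry would be both 1 and \<open>w\<close> on the range of a nonzero idempotent.
\<close>

lemma order_3_of_triangularizable:
  fixes T :: "'a::chilbert_space bop"
  assumes w: "w \<noteq> 1" "1 + w + w\<^sup>2 = 0"
    and T: "triangularizable (scalar 1) (scalar w) (scalar (w\<^sup>2)) T"
  shows "automorphism_of_order_3 T"
proof -
  have w3: "w * w\<^sup>2 = 1" "w + w\<^sup>2 = -1"
  proof -
    show "w + w\<^sup>2 = -1" using w(2) by (simp add: add.assoc eq_neg_iff_add_eq_0 add.commute)
    have "w * w\<^sup>2 - 1 = (w - 1) * (1 + w + w\<^sup>2)" by (simp add: algebra_simps power2_eq_square)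
    then show "w * w\<^sup>2 = 1" using w by simp
  qed
  define s where "s = (scalar w + scalar (w\<^sup>2) :: 'a bop)"
  have s: "s = - 1"
  proof -
    have "s + 1 = scalar (w + w\<^sup>2 + 1)" by (simp add: s_def flip: scalar_simps)
    then show ?thesis using w3(2) by (simp add: scalar_simps eq_neg_iff_add_eq_0)
  qed
  have comm: "T * scalar (w\<^sup>2) = scalar (w\<^sup>2) * T"
    using central_scalar unfolding central_def by metis
  have "(T - scalar w) * (T - scalar (w\<^sup>2)) = T * T - s * T + scalar w * scalar (w\<^sup>2)"
    using comm by (simp add: s_def algebra_simps)
  also have "\<dots> = T * T + T + 1" using w3 by (simp add: s scalar_simps)
  finally have "(T - 1) * (T * T + T + 1) = 0"
    using triangularizable_cubic[OF central_scalar central_scalar central_scalar T]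
    by (simp add: scalar_simps mult.assoc)
  then have T3: "T ^ 3 = 1" by (simp add: algebra_simps power3_eq_cube)
  have "T \<noteq> 1"
  proof
    assume "T = 1"
    obtain f :: "'a bop" where ff: "f * f = f" "f \<noteq> 0" "f * T * f = scalar w * f"
      using T unfolding triangularizable_def orthogonal_idempotents_def by (elim exE conjE) (rule that)
    have f: "f = scalar w * f" using ff(1,3) \<open>T = 1\<close> by simp
    have "f = 0"
    proof (rule bop_eqI)
      fix x
      have "bop_apply f x = w *\<^sub>C bop_apply f x"
        by (subst f) (simp add: scalar.rep_eq)
      then have "(1 - w) *\<^sub>C bop_apply f x = 0"
        by (simp add: complex_vector.scale_left_diff_distrib scaleC_one)
      then show "bop_apply f x = bop_apply 0 x" using w(1) by simp
    qed
    then show False using ff(2) by simp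
  qed
  then show ?thesis
    unfolding automorphism_of_order_3_def using T3
    by (intro conjI exI[of _ "T * T"]) (simp_all add: power3_eq_cube mult.assoc)
qed

theorem corollary3p2:
  assumes "infinite_cdim TYPE('a::chilbert_space)"
  shows "(\<forall>A :: 'a bop. \<exists>Ns. 1 \<le> length Ns \<and> length Ns \<le> 4 \<and>
            (\<forall>N \<in> set Ns. nilpotent N \<and> nilpotency_index N \<le> 3) \<and> A = sum_list Ns) \<and>
         (\<forall>A :: 'a bop. \<exists>Ts. 1 \<le> length Ts \<and> length Ts \<le> 4 \<and>
            (\<forall>T \<in> set Ts. automorphism_of_order_3 T) \<and> A = sum_list Ts)"
proof (intro conjI allI)
  fix A :: "'a bop"
  obtain Ns where "length Ns = 4" "A = sum_list Ns"
    and "\<forall>N \<in> set Ns. triangularizable (scalar 0) (scalar 0) (scalar 0) N"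
    using sum_of_four_triangularizable_operators[OF assms, of 0 0 0 A] by (elim exE conjE) (rule that)
  then show "\<exists>Ns. 1 \<le> length Ns \<and> length Ns \<le> 4 \<and>
            (\<forall>N \<in> set Ns. nilpotent N \<and> nilpotency_index N \<le> 3) \<and> A = sum_list Ns"
    by (intro exI[of _ Ns]) (simp add: nilpotent_of_triangularizable)
next
  fix A :: "'a bop"
  define w where "w = Complex (- 1 / 2) (sqrt 3 / 2)"
  have w: "w \<noteq> 1" "1 + w + w\<^sup>2 = 0"
    by (simp_all add: w_def complex_eq_iff power2_eq_square)
  obtain Ts where "length Ts = 4" "A = sum_list Ts"
    and "\<forall>T \<in> set Ts. triangularizable (scalar 1) (scalar w) (scalar (w\<^sup>2)) T"
    using sum_of_four_triangularizable_operators[OF assms, of 1 w "w\<^sup>2" A] by (elim exE conjE) (rule that)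
  then show "\<exists>Ts. 1 \<le> length Ts \<and> length Ts \<le> 4 \<and>
            (\<forall>T \<in> set Ts. automorphism_of_order_3 T) \<and> A = sum_list Ts"
    by (intro exI[of _ Ts]) (simp add: order_3_of_triangularizable[OF w])
qed

end
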